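(* Let $\mathcal{R}(\Delta^-)=\{\{r,z,\overline z\}\mid z=x+iy,\ x\in\mathbb{R},\ y>0,\ r\in\mathbb{RP}^1\}$ be the space of root-sets of real cubics with exactly one real root and a pair of non-real complex conjugate roots, equipped with the $\mathrm{PSL}(2;\mathbb{R})$ action applying Möbius transformations to each root, and let $\mathrm{UT}\mathbb{H}^2=\{(p,v)\mid p\in\mathbb{H}^2,\ v\in T_p\mathbb{H}^2,\ \|v\|=1\}$ be the unit tangent bundle to the hyperbolic plane (upper half plane model). Define $\Phi\colon\mathcal{R}(\Delta^-)\to\mathrm{UT}\mathbb{H}^2$ by sending $\{r,z,\overline z\}$ to the point $z$ together with the unit tangent vector $v\in T_z\mathbb{H}^2$ which is the initial tangent vector to the geodesic ray $\gamma$ starting at $z$ and limiting to the ideal point $r=\gamma(+\infty)$. Then $\Phi$ is an isomorphism of geometries, i.e. a $\mathrm{PSL}(2;\mathbb{R})$-equivariant homeomorphism.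
   Context: $\mathbb{H}^2$ is the upper half plane $\{x+iy\mid y>0\}$ with the metric $(dx^2+dy^2)/y^2$; its ideal boundary is $\mathbb{RP}^1=\mathbb{R}\cup\{\infty\}$. $\mathcal{R}(\Delta^-)$ is topologized as a subset of $\mathrm{SP}^3(\mathbb{CP}^1)=(\mathbb{CP}^1)^3/S_3$, equivalently as $\mathbb{RP}^1$ times the upper half plane. The action on $\mathcal{R}(\Delta^-)$ is $A\cdot\{r,z,\overline z\}=\{A.r,A.z,A.\overline z\}$; the action on $\mathrm{UT}\mathbb{H}^2$ is by differentials of the Möbius isometries of $\mathbb{H}^2$. *)

theory Defs
  imports "HOL-Analysis.Analysis" "HOL-Algebra.Coset" "HOL-Library.Multiset"
begin

text \<open>A point of \<open>\<complex>\<P>\<^sup>1 = \<complex> \<union> {\<infinity>}\<close> is a \<^typ>\<open>complex option\<close>, where \<^const>\<open>None\<close> is \<open>\<infinity>\<close>.\<close>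

definition CP1 :: "complex option topology" where
  "CP1 = Alexandroff_compactification euclidean"

definition RP1 :: "complex option set" where
  "RP1 = insert None (Some ` \<real>)"

definition triple_mset :: "'a \<times> 'a \<times> 'a \<Rightarrow> 'a multiset" where
  "triple_mset = (\<lambda>(a, b, c). {#a, b, c#})"

text \<open>\<open>X\<^sup>3 / S\<^sub>3\<close> with the quotient topology. Two triples lie in one \<open>S\<^sub>3\<close>-orbit iff they have the
  same multiset of entries, so the orbit of \<open>(a, b, c)\<close> is represented by \<open>{#a, b, c#}\<close>.\<close>

definition SP3 :: "'a topology \<Rightarrow> 'a multiset topology" where
  "SP3 X = topology (\<lambda>U. U \<subseteq> triple_mset ` topspace (prod_topology X (prod_topology X X)) \<and>
     openin (prod_topology X (prod_topology X X))
       {t \<in> topspace (prod_topology X (prod_topology X X)). triple_mset t \<in> U})"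

lemma openin_SP3:
  "openin (SP3 X) U \<longleftrightarrow> U \<subseteq> triple_mset ` topspace (prod_topology X (prod_topology X X)) \<and>
     openin (prod_topology X (prod_topology X X))
       {t \<in> topspace (prod_topology X (prod_topology X X)). triple_mset t \<in> U}"
proof -
  let ?X = "prod_topology X (prod_topology X X)"
  have "istopology (\<lambda>U. U \<subseteq> triple_mset ` topspace ?X \<and>
     openin ?X {t \<in> topspace ?X. triple_mset t \<in> U})"
    unfolding istopology_def
  proof (intro conjI allI impI)
    fix S T assume ST: "S \<subseteq> triple_mset ` topspace ?X \<and> openin ?X {t \<in> topspace ?X. triple_mset t \<in> S}"
      "T \<subseteq> triple_mset ` topspace ?X \<and> openin ?X {t \<in> topspace ?X. triple_mset t \<in> T}"
    show "S \<inter> T \<subseteq> triple_mset ` topspace ?X" using ST by blast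
    have "{t \<in> topspace ?X. triple_mset t \<in> S \<inter> T} =
       {t \<in> topspace ?X. triple_mset t \<in> S} \<inter> {t \<in> topspace ?X. triple_mset t \<in> T}" by blast
    then show "openin ?X {t \<in> topspace ?X. triple_mset t \<in> S \<inter> T}"
      using ST by (simp only: openin_Int)
  next
    fix K assume K: "\<forall>S\<in>K. S \<subseteq> triple_mset ` topspace ?X \<and> openin ?X {t \<in> topspace ?X. triple_mset t \<in> S}"
    show "\<Union>K \<subseteq> triple_mset ` topspace ?X" using K by blast
    have "{t \<in> topspace ?X. triple_mset t \<in> \<Union>K} = (\<Union>S\<in>K. {t \<in> topspace ?X. triple_mset t \<in> S})" by blast
    moreover have "openin ?X (\<Union>S\<in>K. {t \<in> topspace ?X. triple_mset t \<in> S})"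
      using K by (intro openin_Union) auto
    ultimately show "openin ?X {t \<in> topspace ?X. triple_mset t \<in> \<Union>K}" by metis
  qed
  then show ?thesis unfolding SP3_def by simp
qed

lemma topspace_SP3:
  "topspace (SP3 X) = triple_mset ` topspace (prod_topology X (prod_topology X X))"
proof
  show "topspace (SP3 X) \<subseteq> triple_mset ` topspace (prod_topology X (prod_topology X X))"
    using openin_SP3 openin_topspace by blast
  have "{t \<in> topspace (prod_topology X (prod_topology X X)).
      triple_mset t \<in> triple_mset ` topspace (prod_topology X (prod_topology X X))} =
      topspace (prod_topology X (prod_topology X X))" by blast
  then have "openin (SP3 X) (triple_mset ` topspace (prod_topology X (prod_topology X X)))"
    unfolding openin_SP3 by (metis openin_topspace order_refl)
  then show "triple_mset ` topspace (prod_topology X (prod_topology X X)) \<subseteq> topspace (SP3 X)"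
    by (rule openin_subset)
qed

lemma quotient_map_triple_mset:
  "quotient_map (prod_topology X (prod_topology X X)) (SP3 X) triple_mset"
  unfolding quotient_map_def topspace_SP3 openin_SP3 by blast

definition H2 :: "complex set" where
  "H2 = {z. Im z > 0}"

text \<open>\<open>(dx\<^sup>2 + dy\<^sup>2) / y\<^sup>2\<close>; each tangent space \<open>T\<^sub>p \<H>\<^sup>2\<close> is identified with \<open>\<complex>\<close>.\<close>

definition hyp_metric :: "complex \<Rightarrow> complex \<Rightarrow> complex \<Rightarrow> real" where
  "hyp_metric p u v = (u \<bullet> v) / (Im p)\<^sup>2"

definition hyp_norm :: "complex \<Rightarrow> complex \<Rightarrow> real" where
  "hyp_norm p v = sqrt (hyp_metric p v v)"

text \<open>Christoffel symbols of the first kind, extended linearly to arbitrary vectors: for constant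
  vector fields \<open>u\<close>, \<open>v\<close>, \<open>w\<close> the Koszul formula reads
  \<open>2 g(\<nabla>\<^sub>u v, w) = u(g(v, w)) + v(g(u, w)) - w(g(u, v))\<close>.\<close>

definition christoffel1 :: "complex \<Rightarrow> complex \<Rightarrow> complex \<Rightarrow> complex \<Rightarrow> real" where
  "christoffel1 p u v w =
     (frechet_derivative (\<lambda>q. hyp_metric q v w) (at p) u
      + frechet_derivative (\<lambda>q. hyp_metric q u w) (at p) v
      - frechet_derivative (\<lambda>q. hyp_metric q u v) (at p) w) / 2"

lemma christoffel1_eq:
  assumes "p \<in> H2"
  shows "christoffel1 p u v w =
    ((u \<bullet> v) * Im w - (v \<bullet> w) * Im u - (u \<bullet> w) * Im v) / Im p ^ 3"
proof -
  have "((\<lambda>q. hyp_metric q a b) has_derivative (\<lambda>h. - 2 * (a \<bullet> b) * Im h / Im p ^ 3)) (at p)" for a b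
    unfolding hyp_metric_def using assms
    by (auto intro!: derivative_eq_intros simp: H2_def fun_eq_iff field_simps power2_eq_square power3_eq_cube)
  then have "frechet_derivative (\<lambda>q. hyp_metric q a b) (at p) = (\<lambda>h. - 2 * (a \<bullet> b) * Im h / Im p ^ 3)" for a b
    by (metis frechet_derivative_at)
  then show ?thesis
    using assms by (simp add: christoffel1_def H2_def field_simps)
qed

text \<open>The geodesic equation \<open>\<nabla>\<^bsub>\<gamma>'\<^esub> \<gamma>' = 0\<close> on \<open>[0, \<infinity>)\<close>, tested against all vectors \<open>w\<close>; the
  derivatives at \<open>0\<close> are one-sided. The parametrization has constant, but not necessarily unit,
  speed.\<close>

definition geodesic_ray :: "(real \<Rightarrow> complex) \<Rightarrow> bool" where
  "geodesic_ray \<gamma> \<longleftrightarrow>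
     (\<exists>\<gamma>' \<gamma>''. \<forall>t\<ge>0. \<gamma> t \<in> H2 \<and>
        (\<gamma> has_vector_derivative \<gamma>' t) (at t within {0..}) \<and>
        (\<gamma>' has_vector_derivative \<gamma>'' t) (at t within {0..}) \<and>
        (\<forall>w. hyp_metric (\<gamma> t) (\<gamma>'' t) w + christoffel1 (\<gamma> t) (\<gamma>' t) (\<gamma>' t) w = 0))"

lemma geodesic_equation_iff:
  assumes "p \<in> H2"
  shows "(\<forall>w. hyp_metric p a w + christoffel1 p v v w = 0) \<longleftrightarrow> a = - \<i> * v\<^sup>2 / of_real (Im p)"
proof -
  have y: "Im p > 0" using assms by (simp add: H2_def)
  define b where "b = a + \<i> * v\<^sup>2 / of_real (Im p)"
  have Re_b: "Re b = Re a - 2 * Re v * Im v / Im p"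
    and Im_b: "Im b = Im a + ((Re v)\<^sup>2 - (Im v)\<^sup>2) / Im p"
    by (simp_all add: b_def power2_eq_square)
  have "hyp_metric p a w + christoffel1 p v v w = (b \<bullet> w) / (Im p)\<^sup>2" for w
    using y by (simp add: christoffel1_eq[OF assms] hyp_metric_def inner_complex_def Re_b Im_b
        field_simps power2_eq_square power3_eq_cube)
  then have "(\<forall>w. hyp_metric p a w + christoffel1 p v v w = 0) \<longleftrightarrow> (\<forall>w. b \<bullet> w = 0)"
    using y by simp
  also have "\<dots> \<longleftrightarrow> b = 0"
    by (metis inner_eq_zero_iff inner_zero_left)
  also have "\<dots> \<longleftrightarrow> a = - \<i> * v\<^sup>2 / of_real (Im p)"
    by (simp add: b_def eq_neg_iff_add_eq_0)
  finally show ?thesis .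
qed

definition UTH2 :: "(complex \<times> complex) set" where
  "UTH2 = {(p, v). p \<in> H2 \<and> hyp_norm p v = 1}"

definition UTH2_top :: "(complex \<times> complex) topology" where
  "UTH2_top = subtopology euclidean UTH2"

definition root_set :: "complex option \<Rightarrow> complex \<Rightarrow> complex option multiset" where
  "root_set r z = {#r, Some z, Some (cnj z)#}"

definition R_neg :: "complex option multiset set" where
  "R_neg = {root_set r z | r z. r \<in> RP1 \<and> z \<in> H2}"

definition R_neg_top :: "complex option multiset topology" where
  "R_neg_top = subtopology (SP3 CP1) R_neg"

text \<open>\<open>v\<close> is the initial tangent vector of the unit speed geodesic ray from \<open>z\<close> to the ideal
  point \<open>r\<close>.\<close>

definition initial_tangent :: "complex \<Rightarrow> complex option \<Rightarrow> complex \<Rightarrow> bool" where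
  "initial_tangent z r v \<longleftrightarrow>
     (z, v) \<in> UTH2 \<and>
     (\<exists>\<gamma>. geodesic_ray \<gamma> \<and> \<gamma> 0 = z \<and> (\<gamma> has_vector_derivative v) (at 0 within {0..}) \<and>
        limitin CP1 (\<lambda>t. Some (\<gamma> t)) r at_top)"

definition Phi :: "complex option multiset \<Rightarrow> complex \<times> complex" where
  "Phi m = (THE (z, v). \<exists>r\<in>RP1. z \<in> H2 \<and> m = root_set r z \<and> initial_tangent z r v)"

definition SL2R :: "(real^2^2) monoid" where
  "SL2R = \<lparr>carrier = {A. det A = 1}, monoid.mult = (**), one = mat 1\<rparr>"

definition PSL2R :: "(real^2^2) set monoid" where
  "PSL2R = SL2R Mod {mat 1, - mat 1}"

lemma group_SL2R: "group SL2R"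
proof (rule groupI)
  fix A assume "A \<in> carrier SL2R"
  then have A: "det A = 1" by (simp add: SL2R_def)
  then have "invertible A" by (simp add: invertible_det_nz)
  then obtain B where inv: "B ** A = mat 1" by (auto simp: invertible_def)
  then have "det B * det A = 1" by (metis det_I det_mul)
  with A inv show "\<exists>B\<in>carrier SL2R. B \<otimes>\<^bsub>SL2R\<^esub> A = \<one>\<^bsub>SL2R\<^esub>"
    by (intro bexI[of _ B]) (simp_all add: SL2R_def)
qed (simp_all add: SL2R_def det_mul matrix_mul_assoc)

lemma matrix_mult_uminus [simp]:
  fixes A B :: "real^2^2"
  shows "(- A) ** B = - (A ** B)" "A ** (- B) = - (A ** B)"
  by (simp_all add: matrix_matrix_mult_def vec_eq_iff sum_negf)

lemma det_uminus_mat_1: "det (- mat 1 :: real^2^2) = 1"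
  by (simp add: det_2 mat_def)

lemma normal_SL2R: "{mat 1, - mat 1} \<lhd> SL2R"
proof -
  interpret group SL2R by (rule group_SL2R)
  have inv: "inv\<^bsub>SL2R\<^esub> (- mat 1) = - mat 1"
    by (rule inv_equality) (auto simp: SL2R_def det_uminus_mat_1)
  have inv1: "inv\<^bsub>SL2R\<^esub> (mat 1) = mat 1"
    by (rule inv_equality) (auto simp: SL2R_def)
  have "subgroup {mat 1, - mat 1} SL2R"
    by (rule subgroupI) (auto simp: inv inv1, auto simp: SL2R_def det_uminus_mat_1)
  then show ?thesis
    by (intro normalI) (auto simp: SL2R_def r_coset_def l_coset_def)
qed

lemma carrier_PSL2R: "carrier PSL2R = {{A, - A} | A. det A = 1}"
  unfolding PSL2R_def FactGroup_def RCOSETS_def r_coset_def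
  by (auto simp: SL2R_def)

definition moebius_map :: "real^2^2 \<Rightarrow> complex \<Rightarrow> complex" where
  "moebius_map A =
     moebius (of_real (A$1$1)) (of_real (A$1$2)) (of_real (A$2$1)) (of_real (A$2$2))"

fun moebius_CP1 :: "real^2^2 \<Rightarrow> complex option \<Rightarrow> complex option" where
  "moebius_CP1 A None = (if A$2$1 = 0 then None else Some (of_real (A$1$1 / A$2$1)))"
| "moebius_CP1 A (Some z) =
     (if of_real (A$2$1) * z + of_real (A$2$2) = 0 then None else Some (moebius_map A z))"

definition SL_act_roots :: "real^2^2 \<Rightarrow> complex option multiset \<Rightarrow> complex option multiset" where
  "SL_act_roots A m = image_mset (moebius_CP1 A) m"

definition SL_act_UT :: "real^2^2 \<Rightarrow> complex \<times> complex \<Rightarrow> complex \<times> complex" where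
  "SL_act_UT A = (\<lambda>(p, v). (moebius_map A p, frechet_derivative (moebius_map A) (at p) v))"

text \<open>An element of \<open>PSL(2;\<real>)\<close> is a coset \<open>{A, -A}\<close>, acting by the common value of its
  representatives.\<close>

definition PSL_act_roots :: "(real^2^2) set \<Rightarrow> complex option multiset \<Rightarrow> complex option multiset" where
  "PSL_act_roots C m = (THE m'. \<forall>A\<in>C. SL_act_roots A m = m')"

definition PSL_act_UT :: "(real^2^2) set \<Rightarrow> complex \<times> complex \<Rightarrow> complex \<times> complex" where
  "PSL_act_UT C x = (THE y. \<forall>A\<in>C. SL_act_UT A x = y)"

lemma moebius_map_uminus: "moebius_map (- A) = moebius_map A"
proof
  fix z
  have "moebius_map (- A) z = (- (of_real (A$1$1) * z + of_real (A$1$2))) /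
      (- (of_real (A$2$1) * z + of_real (A$2$2)))"
    by (simp add: moebius_map_def moebius_def)
  also have "\<dots> = moebius_map A z"
    unfolding minus_divide_divide by (simp add: moebius_map_def moebius_def)
  finally show "moebius_map (- A) z = moebius_map A z" .
qed

lemma moebius_CP1_uminus: "moebius_CP1 (- A) = moebius_CP1 A"
proof
  fix x
  have *: "- a = b \<longleftrightarrow> a + b = 0" for a b :: complex
    by (simp add: add_eq_0_iff) metis
  show "moebius_CP1 (- A) x = moebius_CP1 A x"
    by (cases x) (simp_all add: moebius_map_uminus *)
qed

lemma PSL_act_eq:
  assumes "C \<in> carrier PSL2R" "A \<in> C"
  shows "PSL_act_roots C m = SL_act_roots A m" "PSL_act_UT C x = SL_act_UT A x"
  using assms
  by (auto simp: carrier_PSL2R PSL_act_roots_def PSL_act_UT_def SL_act_roots_def SL_act_UT_def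
      moebius_map_uminus moebius_CP1_uminus)

end

theory Submission
  imports Defs
begin

text \<open>In the Cayley chart \<open>w \<mapsto> (w - z) / (w - cnj z)\<close>, which is \<open>h \<mapsto> h / (2 i Im z)\<close> to first order at
  \<open>z\<close>, geodesics through \<open>z\<close> become diameters, so the unit vector at \<open>z\<close> pointing to \<open>r\<close> is
  \<open>i Im z (r - z) / (r - cnj z)\<close>. That it is the only initial tangent follows from the hyperboloid
  coordinates: along a unit speed geodesic \<open>x + i y\<close> the functions \<open>1 / y\<close> and \<open>x / y\<close> satisfy
  \<open>f'' = f\<close>, so the initial vector determines the geodesic and hence its endpoint. With this formula
  \<open>\<Phi>\<close> is, up to the identification of \<open>\<R>\<P>\<^sup>1\<close> with the unit circle by the Cayley chart at \<open>i\<close>,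
  a rational map with rational inverse, and equivariance is
  \<open>A r - A z = (r - z) / ((c r + d) (c z + d))\<close>.\<close>

section \<open>Directions and ideal endpoints\<close>

text \<open>The real solution \<open>a\<close> of \<open>u = (a - z) / (a - cnj z)\<close>:
  stereographic projection of the circle from \<open>1\<close>, reflected, scaled by
  \<open>Im z\<close> and shifted by \<open>Re z\<close>.\<close>

definition endpoint :: "complex \<Rightarrow> complex \<Rightarrow> complex option" where
  "endpoint z u = (if u = 1 then None else Some (of_real (Re z - Im z * Im u / (1 - Re u))))"

text \<open>The Cayley chart at \<open>z\<close>, used on boundary points; the value
  \<open>1\<close> at \<open>None\<close> is its limit at infinity. The tangent vector itself is
  this number times \<open>\<i> * of_real (Im z)\<close>.\<close>

fun direction :: "complex \<Rightarrow> complex option \<Rightarrow> complex" where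
  "direction z None = 1"
| "direction z (Some a) = (a - z) / (a - cnj z)"

lemma norm_eq_1_complex: "norm u = 1 \<longleftrightarrow> (Re u)\<^sup>2 + (Im u)\<^sup>2 = 1"
  by (simp add: cmod_def)

lemma unit_Re_eq_1: "norm u = 1 \<Longrightarrow> Re u = 1 \<longleftrightarrow> u = 1"
  by (auto simp: norm_eq_1_complex complex_eq_iff)

lemma unit_Re_less_1: "norm u = 1 \<Longrightarrow> u \<noteq> 1 \<Longrightarrow> Re u < 1"
  using complex_Re_le_cmod[of u] unit_Re_eq_1[of u] by linarith

lemma endpoint_in_RP1: "endpoint z u \<in> RP1"
  by (simp add: endpoint_def RP1_def)

lemma real_minus_cnj_nonzero: "z \<in> H2 \<Longrightarrow> of_real a - cnj z \<noteq> 0"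
  by (auto simp: H2_def complex_eq_iff)

lemma norm_direction:
  assumes "z \<in> H2" "r \<in> RP1"
  shows "norm (direction z r) = 1"
proof -
  have "norm (of_real a - z) = norm (of_real a - cnj z)" for a
    by (simp add: cmod_def)
  then show ?thesis
    using assms real_minus_cnj_nonzero[of z] by (auto simp: RP1_def Reals_def norm_divide)
qed

lemma endpoint_direction:
  assumes z: "z \<in> H2" and r: "r \<in> RP1"
  shows "endpoint z (direction z r) = r"
proof (cases r)
  case (Some c)
  then obtain a where [simp]: "r = Some (of_real a)" using r by (auto simp: RP1_def Reals_def)
  define d where "d = a - Re z"
  have y: "Im z > 0" using z by (simp add: H2_def)
  then have pos: "d\<^sup>2 + (Im z)\<^sup>2 > 0" by (simp add: add_nonneg_pos)
  have Re: "Re (direction z r) = (d\<^sup>2 - (Im z)\<^sup>2) / (d\<^sup>2 + (Im z)\<^sup>2)"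
    by (simp add: Re_divide d_def power2_eq_square)
  have Im: "Im (direction z r) = - 2 * d * Im z / (d\<^sup>2 + (Im z)\<^sup>2)"
    by (simp add: Im_divide d_def power2_eq_square algebra_simps)
  have 1: "1 - Re (direction z r) = 2 * (Im z)\<^sup>2 / (d\<^sup>2 + (Im z)\<^sup>2)"
  proof -
    have "1 - (a - b) / (a + b) = 2 * b / (a + b)" if "a + b > 0" for a b :: real
      using that by (simp add: field_simps)
    then show ?thesis unfolding Re using pos by blast
  qed
  then have "1 - Re (direction z r) \<noteq> 0" using y pos by auto
  then have "direction z r \<noteq> 1" by auto
  moreover have "Im z * Im (direction z r) / (1 - Re (direction z r)) = - d"
  proof -
    have "b * (- 2 * d * b / e) / (2 * b\<^sup>2 / e) = - d" if "b > 0" "e > 0" for b e :: real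
      using that by (simp add: field_simps power2_eq_square)
    then show ?thesis unfolding 1 Im using y pos by blast
  qed
  ultimately show ?thesis
    by (simp add: endpoint_def d_def)
qed (simp add: endpoint_def)

lemma direction_endpoint:
  assumes z: "z \<in> H2" and u: "norm u = 1"
  shows "direction z (endpoint z u) = u"
proof (cases "u = 1")
  case False
  define c s y where "c = Re u" and "s = Im u" and "y = Im z"
  have c: "1 - c > 0" using unit_Re_less_1[OF u False] by (simp add: c_def)
  have cs: "c\<^sup>2 + s\<^sup>2 = 1" using u by (simp add: norm_eq_1_complex c_def s_def)
  define a where "a = Re z - y * s / (1 - c)"
  have e: "endpoint z u = Some (of_real a)"
    using False by (simp add: endpoint_def a_def c_def s_def y_def)
  have 1: "of_real a - z = Complex (- y * s / (1 - c)) (- y)"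
    by (simp add: complex_eq_iff a_def y_def)
  have 2: "of_real a - cnj z = Complex (- y * s / (1 - c)) y"
    by (simp add: complex_eq_iff a_def y_def)
  \<comment> \<open>After clearing \<open>1 - c\<close> the real parts agree identically and the
    imaginary parts agree by \<open>c\<^sup>2 + s\<^sup>2 = 1\<close>.\<close>
  have "of_real a - z = u * (of_real a - cnj z)"
    unfolding 1 2 using c cs
    by (simp add: complex_eq_iff c_def[symmetric] s_def[symmetric] field_simps power2_eq_square) algebra
  then show ?thesis
    using real_minus_cnj_nonzero[OF z, of a] by (simp add: e)
qed (simp add: endpoint_def)

section \<open>Geodesic rays\<close>

text \<open>The equation \<open>f'' = f\<close> decouples: \<open>(f + f') * exp (- t)\<close> and
  \<open>(f - f') * exp t\<close> are both constant, and \<open>f\<close> is recovered from the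
  two.\<close>

lemma deriv_eq_self_twice_imp:
  fixes f f' :: "real \<Rightarrow> real"
  assumes f: "\<And>t. t \<ge> 0 \<Longrightarrow> (f has_real_derivative f' t) (at t within {0..})"
    and f': "\<And>t. t \<ge> 0 \<Longrightarrow> (f' has_real_derivative f t) (at t within {0..})"
    and t: "t \<ge> 0"
  shows "f t = f 0 * cosh t + f' 0 * sinh t"
proof -
  have "\<exists>k. \<forall>t\<in>{0..}. (f t + f' t) * exp (- t) = k"
    by (rule has_field_derivative_zero_constant)
      (auto intro!: derivative_eq_intros f f' simp: algebra_simps)
  then have 1: "(f t + f' t) * exp (- t) = f 0 + f' 0"
    using t by force
  have "\<exists>k. \<forall>t\<in>{0..}. (f t - f' t) * exp t = k"
    by (rule has_field_derivative_zero_constant)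
      (auto intro!: derivative_eq_intros f f' simp: algebra_simps)
  then have 2: "(f t - f' t) * exp t = f 0 - f' 0"
    using t by force
  have "f t + f' t = (f 0 + f' 0) * exp t" "f t - f' t = (f 0 - f' 0) * exp (- t)"
    using 1 2 by (simp_all add: exp_minus field_simps)
  then show ?thesis
    by (simp add: cosh_def sinh_def field_simps)
qed

text \<open>Hyperboloid coordinates solved for the curve: if \<open>X + \<i> Y\<close> is the point
  at time \<open>t\<close>, then \<open>Im z / Y = cosh t - Re u * sinh t\<close> and
  \<open>(X - Re z) / Y = - Im u * sinh t\<close>.\<close>

definition unit_geodesic :: "complex \<Rightarrow> complex \<Rightarrow> real \<Rightarrow> complex" where
  "unit_geodesic z u t =
     of_real (Re z) + of_real (Im z) * ((\<i> - of_real (Im u * sinh t)) / of_real (cosh t - Re u * sinh t))"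

lemma cosh_minus_sinh_pos:
  fixes c :: real
  assumes "\<bar>c\<bar> \<le> 1"
  shows "cosh t - c * sinh t > 0"
proof -
  have "c * sinh t \<le> \<bar>c\<bar> * \<bar>sinh t\<bar>"
    by (metis abs_ge_self abs_mult)
  also have "\<dots> \<le> 1 * \<bar>sinh t\<bar>"
    using assms by (intro mult_right_mono) auto
  also have "1 * \<bar>sinh t\<bar> < cosh t"
    by (simp add: cosh_def sinh_def abs_less_iff)
  finally show ?thesis by simp
qed

lemma has_vector_derivative_Complex:
  assumes "(f has_real_derivative f') (at t within A)" "(g has_real_derivative g') (at t within A)"
  shows "((\<lambda>t. Complex (f t) (g t)) has_vector_derivative Complex f' g') (at t within A)"
  unfolding Complex_eq using assms
  by (auto intro!: derivative_eq_intros simp: has_real_derivative_iff_has_vector_derivative)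

lemma unit_geodesic_0: "unit_geodesic z u 0 = z"
  by (simp add: unit_geodesic_def complex_eq_iff)

lemma unit_geodesic:
  assumes z: "z \<in> H2" and u: "norm u = 1"
  shows "geodesic_ray (unit_geodesic z u)"
    and "(unit_geodesic z u has_vector_derivative \<i> * of_real (Im z) * u) (at 0 within {0..})"
proof -
  define c s y where "c = Re u" and "s = Im u" and "y = Im z"
  have y: "y > 0" using z by (simp add: H2_def y_def)
  have cs: "c\<^sup>2 + s\<^sup>2 = 1" using u by (simp add: norm_eq_1_complex c_def s_def)
  have uc: "u = Complex c s" by (simp add: c_def s_def)
  have "\<bar>c\<bar> \<le> 1" using abs_Re_le_cmod[of u] u by (simp add: c_def)
  note Qpos = cosh_minus_sinh_pos[OF this]
  \<comment> \<open>\<open>Q\<close> is the denominator of the curve; since \<open>Q' = R\<close>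
    and \<open>R' = Q\<close>, its velocity and acceleration are rational in \<open>Q\<close> and
    \<open>R\<close>.\<close>
  define Q R where "Q = (\<lambda>t. cosh t - c * sinh t)" and "R = (\<lambda>t. sinh t - c * cosh t)"
  have Qp: "Q t > 0" for t using Qpos by (simp add: Q_def)
  \<comment> \<open>A first integral of \<open>Q'' = Q\<close>, used to eliminate
    \<open>Q\<^sup>2\<close> in the second derivative.\<close>
  have QR: "(Q t)\<^sup>2 - (R t)\<^sup>2 = s\<^sup>2" for t
  proof -
    have "(Q t)\<^sup>2 - (R t)\<^sup>2 = ((cosh t)\<^sup>2 - (sinh t)\<^sup>2) * (1 - c\<^sup>2)"
      by (simp add: Q_def R_def power2_eq_square algebra_simps)
    then show ?thesis using cs by (simp add: hyperbolic_pythagoras)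
  qed
  \<comment> \<open>\<open>h\<close> is read off from the geodesic equation instead of being
    computed as a derivative, so the equation holds by construction and the work lies in
    \<open>dg\<close>.\<close>
  define f g h where "f = unit_geodesic z u"
    and "g = (\<lambda>t. Complex (- y * s / (Q t)\<^sup>2) (- y * R t / (Q t)\<^sup>2))"
    and "h = (\<lambda>t. - \<i> * (g t)\<^sup>2 / of_real (Im (f t)))"
  have f: "f = (\<lambda>t. Complex (Re z - y * s * sinh t / Q t) (y / Q t))"
    by (simp add: f_def unit_geodesic_def Q_def y_def s_def c_def fun_eq_iff complex_eq_iff
        Re_divide_of_real Im_divide_of_real)
  have dQ: "(Q has_real_derivative R t) (at t within A)" for t A
    unfolding Q_def R_def by (auto intro!: derivative_eq_intros)
  have dR: "(R has_real_derivative Q t) (at t within A)" for t A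
    unfolding Q_def R_def by (auto intro!: derivative_eq_intros)
  have Q0: "Q t \<noteq> 0" for t using Qp[of t] by simp
  have df: "(f has_vector_derivative g t) (at t within A)" for t A
  proof -
    \<comment> \<open>The numerator in the quotient rule for \<open>sinh t / Q t\<close>; as it is
      \<open>1\<close>, the real part of \<open>g\<close> has a constant numerator.\<close>
    have "cosh t * Q t - sinh t * R t = 1"
      using hyperbolic_pythagoras[of t] unfolding Q_def R_def by algebra
    then have "cosh t * (y * s) * Q t - y * s * sinh t * R t = y * s" by algebra
    then show ?thesis
      unfolding f g_def
      by (intro has_vector_derivative_Complex)
        (auto intro!: derivative_eq_intros dQ simp: Q0 power2_eq_square diff_divide_distrib[symmetric])
  qed
  have dg: "(g has_vector_derivative h t) (at t within A)" for t A
  proof -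
    have h: "h t = Complex (2 * y * s * R t / Q t ^ 3) (y * ((R t)\<^sup>2 - s\<^sup>2) / Q t ^ 3)"
      using y Q0[of t] by (simp add: h_def g_def f complex_eq_iff Re_divide_of_real Im_divide_of_real
        field_simps power2_eq_square power3_eq_cube)
    have 1: "((\<lambda>t. - y * s / (Q t)\<^sup>2) has_real_derivative 2 * y * s * R t / Q t ^ 3) (at t within A)"
      by (rule derivative_eq_intros dQ refl | simp add: Q0)+
        (use Q0[of t] in \<open>simp add: field_simps power2_eq_square power3_eq_cube power4_eq_xxxx\<close>)
    have "((\<lambda>t. - y * R t / (Q t)\<^sup>2) has_real_derivative y * (2 * (R t)\<^sup>2 - (Q t)\<^sup>2) / Q t ^ 3) (at t within A)"
      by (rule derivative_eq_intros dQ dR refl | simp add: Q0)+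
        (use Q0[of t] in \<open>simp add: field_simps power2_eq_square power3_eq_cube power4_eq_xxxx\<close>)
    also have "2 * (R t)\<^sup>2 - (Q t)\<^sup>2 = (R t)\<^sup>2 - s\<^sup>2"
      using QR[of t] by simp
    finally show ?thesis
      unfolding h unfolding g_def by (rule has_vector_derivative_Complex[OF 1])
  qed
  show "geodesic_ray (unit_geodesic z u)"
    unfolding geodesic_ray_def f_def[symmetric]
  proof (intro exI allI impI conjI)
    fix t
    show H2: "f t \<in> H2" using y Qp[of t] by (simp add: H2_def f)
    show "hyp_metric (f t) (h t) w + christoffel1 (f t) (g t) (g t) w = 0" for w
      using geodesic_equation_iff[OF H2, of "h t" "g t"] unfolding h_def by blast
  qed (rule df dg)+
  have "g 0 = \<i> * of_real (Im z) * u"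
    by (simp add: g_def Q_def R_def uc complex_eq_iff y_def)
  then show "(unit_geodesic z u has_vector_derivative \<i> * of_real (Im z) * u) (at 0 within {0..})"
    using df[of 0 "{0..}"] by (simp add: f_def)
qed

text \<open>Explicit integration: constant speed turns the nonlinear geodesic system into a linear
  equation for \<open>1 / Y\<close> and \<open>(X - X 0) / Y\<close>, whose initial data are fixed
  by \<open>z\<close> and \<open>u\<close>.\<close>

lemma geodesic_ray_eq_unit_geodesic:
  assumes "geodesic_ray \<gamma>" and z: "\<gamma> 0 = z" and v: "(\<gamma> has_vector_derivative v) (at 0 within {0..})"
    and u: "v = \<i> * of_real (Im z) * u" "norm u = 1" and t: "t \<ge> 0"
  shows "\<gamma> t = unit_geodesic z u t"
proof -
  obtain \<gamma>' \<gamma>'' where geo: "\<forall>t\<ge>0. \<gamma> t \<in> H2 \<and>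
        (\<gamma> has_vector_derivative \<gamma>' t) (at t within {0..}) \<and>
        (\<gamma>' has_vector_derivative \<gamma>'' t) (at t within {0..}) \<and>
        (\<forall>w. hyp_metric (\<gamma> t) (\<gamma>'' t) w + christoffel1 (\<gamma> t) (\<gamma>' t) (\<gamma>' t) w = 0)"
    using assms(1) unfolding geodesic_ray_def by blast
  then have H2: "\<gamma> t \<in> H2"
    and d: "(\<gamma> has_vector_derivative \<gamma>' t) (at t within {0..})" if "t \<ge> 0" for t
    using that by auto
  have "\<gamma>'' t = - \<i> * (\<gamma>' t)\<^sup>2 / of_real (Im (\<gamma> t))" if "t \<ge> 0" for t
    using geodesic_equation_iff[OF H2[OF that]] geo that by blast
  then have d': "(\<gamma>' has_vector_derivative - \<i> * (\<gamma>' t)\<^sup>2 / of_real (Im (\<gamma> t))) (at t within {0..})"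
    if "t \<ge> 0" for t using geo that by simp
  have y: "Im (\<gamma> t) > 0" if "t \<ge> 0" for t using H2[OF that] by (simp add: H2_def)
  then have y0: "Im (\<gamma> t) \<noteq> 0" if "t \<ge> 0" for t using that by fastforce
  have v: "\<gamma>' 0 = v"
    using d[of 0] v by (intro vector_derivative_unique_within[of 0 "{0..}"])
      (auto simp: at_within_Ici_at_right)
  define X Y A B where "X = (\<lambda>t. Re (\<gamma> t))" and "Y = (\<lambda>t. Im (\<gamma> t))"
    and "A = (\<lambda>t. Re (\<gamma>' t))" and "B = (\<lambda>t. Im (\<gamma>' t))"
  note defs = X_def Y_def A_def B_def
  have Y0: "Y t \<noteq> 0" if "t \<ge> 0" for t using y0[OF that] by (simp add: Y_def)
  have dX: "(X has_real_derivative A t) (at t within {0..})" if "t \<ge> 0" for t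
    using bounded_linear.has_vector_derivative[OF bounded_linear_Re d[OF that]]
    by (simp add: defs has_real_derivative_iff_has_vector_derivative)
  have dY: "(Y has_real_derivative B t) (at t within {0..})" if "t \<ge> 0" for t
    using bounded_linear.has_vector_derivative[OF bounded_linear_Im d[OF that]]
    by (simp add: defs has_real_derivative_iff_has_vector_derivative)
  have dA: "(A has_real_derivative 2 * A t * B t / Y t) (at t within {0..})" if "t \<ge> 0" for t
    using bounded_linear.has_vector_derivative[OF bounded_linear_Re d'[OF that]]
    by (simp add: defs has_real_derivative_iff_has_vector_derivative power2_eq_square algebra_simps)
  have dB: "(B has_real_derivative - (((A t)\<^sup>2 - (B t)\<^sup>2) / Y t)) (at t within {0..})" if "t \<ge> 0" for t
    using bounded_linear.has_vector_derivative[OF bounded_linear_Im d'[OF that]]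
    by (simp add: defs has_real_derivative_iff_has_vector_derivative power2_eq_square algebra_simps)
  have A0: "A 0 = - Im z * Im u" and B0: "B 0 = Im z * Re u" and X0: "X 0 = Re z" and Y00: "Y 0 = Im z"
    by (simp_all add: defs v u z)
  \<comment> \<open>The geodesic equation conserves the squared hyperbolic speed; its value is
    \<open>1\<close> because \<open>u\<close> has norm \<open>1\<close>.\<close>
  have "\<exists>k. \<forall>t\<in>{0..}. ((A t)\<^sup>2 + (B t)\<^sup>2) / (Y t)\<^sup>2 = k"
    by (rule has_field_derivative_zero_constant)
      (auto intro!: derivative_eq_intros dA dB dY simp: Y0 field_simps power2_eq_square)
  then have "((A t)\<^sup>2 + (B t)\<^sup>2) / (Y t)\<^sup>2 = ((A 0)\<^sup>2 + (B 0)\<^sup>2) / (Y 0)\<^sup>2" if "t \<ge> 0" for t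
    using that by force
  moreover have "((A 0)\<^sup>2 + (B 0)\<^sup>2) / (Y 0)\<^sup>2 = 1"
    using z y0[of 0] u(2) by (simp add: A0 B0 Y00 norm_eq_1_complex power_mult_distrib flip: distrib_left)
  ultimately have speed: "(A t)\<^sup>2 + (B t)\<^sup>2 = (Y t)\<^sup>2" if "t \<ge> 0" for t
    using that Y0[OF that] by (simp add: field_simps)
  \<comment> \<open>\<open>f\<close> and the \<open>g\<close> below are the linearizing coordinates.
    Subtracting \<open>X 0\<close> makes \<open>g 0 = 0\<close>, so only the \<open>sinh\<close>
    term of \<open>g\<close> survives.\<close>
  define f f' where "f = (\<lambda>t. 1 / Y t)" and "f' = (\<lambda>t. - B t / (Y t)\<^sup>2)"
  define g g' where "g = (\<lambda>t. (X t - X 0) / Y t)"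
    and "g' = (\<lambda>t. (A t * Y t - (X t - X 0) * B t) / (Y t)\<^sup>2)"
  have "f t = f 0 * cosh t + f' 0 * sinh t"
  proof (rule deriv_eq_self_twice_imp[OF _ _ t])
    fix t :: real assume t: "t \<ge> 0"
    show "(f has_real_derivative f' t) (at t within {0..})"
      unfolding f_def f'_def using t
      by (auto intro!: derivative_eq_intros dY simp: Y0 power2_eq_square)
    \<comment> \<open>The geodesic equation alone leaves the factor
      \<open>A\<^sup>2 + B\<^sup>2\<close>; unit speed turns it into \<open>Y\<^sup>2\<close>, which
      gives \<open>f'' = f\<close>.\<close>
    have "(f' has_real_derivative ((A t)\<^sup>2 + (B t)\<^sup>2) / Y t ^ 3) (at t within {0..})"
      unfolding f'_def using t
      by (auto intro!: derivative_eq_intros dY dB simp: Y0 field_simps power2_eq_square power3_eq_cube)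
    moreover have "((A t)\<^sup>2 + (B t)\<^sup>2) / Y t ^ 3 = f t"
      unfolding speed[OF t] f_def using Y0[OF t] by (simp add: power2_eq_square power3_eq_cube)
    ultimately show "(f' has_real_derivative f t) (at t within {0..})" by simp
  qed
  moreover have "g t = g 0 * cosh t + g' 0 * sinh t"
  proof (rule deriv_eq_self_twice_imp[OF _ _ t])
    fix t :: real assume t: "t \<ge> 0"
    show "(g has_real_derivative g' t) (at t within {0..})"
      unfolding g_def g'_def using t
      by (auto intro!: derivative_eq_intros dX dY simp: Y0 power2_eq_square)
    have "(g' has_real_derivative ((A t)\<^sup>2 + (B t)\<^sup>2) * (X t - X 0) / Y t ^ 3) (at t within {0..})"
      unfolding g'_def using t
      by (auto intro!: derivative_eq_intros dX dY dA dB simp: Y0 field_simps power2_eq_square power3_eq_cube)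
    moreover have "((A t)\<^sup>2 + (B t)\<^sup>2) * (X t - X 0) / Y t ^ 3 = g t"
      unfolding speed[OF t] g_def using Y0[OF t] by (simp add: power2_eq_square power3_eq_cube)
    ultimately show "(g' has_real_derivative g t) (at t within {0..})" by simp
  qed
  ultimately have 1: "1 / Y t = 1 / Y 0 * cosh t - B 0 / (Y 0)\<^sup>2 * sinh t" 
    and 2: "(X t - X 0) / Y t = A 0 / Y 0 * sinh t"
    using Y0[of 0] by (simp_all add: f_def f'_def g_def g'_def power2_eq_square)
  have y: "Im z > 0" using y[of 0] by (simp add: z)
  have "\<bar>Re u\<bar> \<le> 1" using abs_Re_le_cmod[of u] u by simp
  from cosh_minus_sinh_pos[OF this, of t] have Q: "cosh t - Re u * sinh t > 0" .
  have "1 / Y t = (cosh t - Re u * sinh t) / Im z"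
    using y unfolding 1 B0 Y00 by (simp add: field_simps power2_eq_square)
  then have Y: "Y t = Im z / (cosh t - Re u * sinh t)"
    using y Q Y0[OF t] by (simp add: field_simps)
  have "(X t - Re z) / Y t = - Im u * sinh t"
    using y 2 unfolding A0 Y00 X0 by simp
  then have "X t = Re z - Im u * sinh t * Y t"
    using Y0[OF t] by (simp add: field_simps)
  then show ?thesis
    using Y by (simp add: complex_eq_iff unit_geodesic_def Re_divide_of_real Im_divide_of_real X_def Y_def)
qed

section \<open>Convergence of geodesics to ideal points\<close>

lemma Hausdorff_CP1: "Hausdorff_space CP1"
  unfolding CP1_def by (simp add: Hausdorff_space_Alexandroff_compactification locally_compact_space_euclidean)

text \<open>For \<open>u = 1\<close> the ray is vertical with height \<open>Im z * exp t\<close>.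
  Otherwise numerator and denominator are divided by \<open>cosh t\<close>, and
  \<open>tanh t\<close> tends to \<open>1\<close>.\<close>

lemma unit_geodesic_limit:
  assumes z: "z \<in> H2" and u: "norm u = 1"
  shows "limitin CP1 (\<lambda>t. Some (unit_geodesic z u t)) (endpoint z u) at_top"
proof (cases "u = 1")
  case True
  have Im: "Im (unit_geodesic z u t) = Im z * exp t" for t
    using True by (simp add: unit_geodesic_def Im_divide_of_real cosh_minus_sinh exp_minus inverse_eq_divide)
  have y: "Im z > 0" using z by (simp add: H2_def)
  show ?thesis
    unfolding limitin_def
  proof (intro conjI allI impI)
    \<comment> \<open>A neighbourhood of \<open>None\<close> omits only a compact, hence bounded,
      set of finite points, while the height grows without bound.\<close>
    fix U assume "openin CP1 U \<and> endpoint z u \<in> U"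
    then obtain C where C: "compact C" "U = insert None (Some ` (- C))"
      using True by (auto simp: CP1_def openin_Alexandroff_compactification endpoint_def Compl_eq_Diff_UNIV)
    then obtain b where b: "\<And>w. w \<in> C \<Longrightarrow> norm w \<le> b"
      using compact_imp_bounded bounded_iff by metis
    have "\<forall>\<^sub>F t in at_top. exp t > b / Im z"
      using exp_at_top by (simp add: filterlim_at_top_dense)
    then show "\<forall>\<^sub>F t in at_top. Some (unit_geodesic z u t) \<in> U"
    proof eventually_elim
      case (elim t)
      then have "b < Im (unit_geodesic z u t)" using y by (simp add: Im field_simps)
      also have "\<dots> \<le> norm (unit_geodesic z u t)"
        using abs_Im_le_cmod abs_le_D1 by blast
      finally show ?case using b C by fastforce
    qed
  qed (simp add: CP1_def True endpoint_def)
next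
  case False
  define c s where "c = Re u" and "s = Im u"
  have c: "1 - c > 0" using unit_Re_less_1[OF u False] by (simp add: c_def)
  have "((\<lambda>t. (\<i> - of_real (s * sinh t)) / of_real (cosh t - c * sinh t)) \<longlongrightarrow> of_real (- s / (1 - c))) at_top"
  proof -
    have cosh: "((\<lambda>t::real. 1 / cosh t) \<longlongrightarrow> 0) at_top"
      using tendsto_inverse_0_at_top[OF cosh_real_at_top] by (simp add: inverse_eq_divide)
    have "((\<lambda>t. (\<i> * of_real (1 / cosh t) - of_real (s * tanh t)) / of_real (1 - c * tanh t)) \<longlongrightarrow>
        (\<i> * of_real 0 - of_real (s * 1)) / of_real (1 - c * 1)) at_top"
      using c by (intro tendsto_intros cosh tanh_real_at_top) auto
    moreover have "(\<i> * of_real (1 / cosh t) - of_real (s * tanh t)) / of_real (1 - c * tanh t) =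
        (\<i> - of_real (s * sinh t)) / of_real (cosh t - c * sinh t)" for t
    proof -
      have "(\<i> - of_real (s * sinh t)) / of_real (cosh t - c * sinh t) =
          ((\<i> - of_real (s * sinh t)) / of_real (cosh t)) / (of_real (cosh t - c * sinh t) / of_real (cosh t))"
        by simp
      also have "(\<i> - of_real (s * sinh t)) / of_real (cosh t) = \<i> * of_real (1 / cosh t) - of_real (s * tanh t)"
        by (simp add: tanh_def diff_divide_distrib)
      also have "of_real (cosh t - c * sinh t) / of_real (cosh t) = (of_real (1 - c * tanh t) :: complex)"
        by (simp add: tanh_def diff_divide_distrib)
      finally show ?thesis by simp
    qed
    ultimately show ?thesis by simp
  qed
  then have "((\<lambda>t. of_real (Re z) + of_real (Im z) * ((\<i> - of_real (s * sinh t)) / of_real (cosh t - c * sinh t)))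
     \<longlongrightarrow> of_real (Re z) + of_real (Im z) * of_real (- s / (1 - c))) at_top"
    by (intro tendsto_intros)
  then have "limitin euclidean (unit_geodesic z u) (of_real (Re z - Im z * s / (1 - c))) at_top"
    by (simp add: unit_geodesic_def[abs_def] c_def s_def)
  then have "limitin CP1 (Some \<circ> unit_geodesic z u) (Some (of_real (Re z - Im z * s / (1 - c)))) at_top"
    unfolding CP1_def by (rule continuous_map_limit[OF continuous_map_Some])
  then show ?thesis
    using False by (simp add: endpoint_def c_def s_def o_def)
qed

section \<open>Unit tangent vectors and their directions\<close>

lemma hyp_norm_eq_1: "z \<in> H2 \<Longrightarrow> hyp_norm z v = 1 \<longleftrightarrow> norm v = Im z"
  by (auto simp: hyp_norm_def hyp_metric_def H2_def real_sqrt_divide simp flip: norm_eq_sqrt_inner)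

text \<open>Dividing by \<open>\<i> * of_real (Im z)\<close> normalizes the length and rotates the
  upward vertical vector to \<open>1\<close>, the direction of \<open>None\<close>.\<close>

lemma UTH2_eq: "UTH2 = {(z, \<i> * of_real (Im z) * u) | z u. z \<in> H2 \<and> norm u = 1}"
proof (intro subset_antisym subrelI)
  fix z v assume "(z, v) \<in> UTH2"
  then have "z \<in> H2" "norm v = Im z" "Im z > 0"
    using hyp_norm_eq_1 by (auto simp: UTH2_def H2_def)
  then have "v = \<i> * of_real (Im z) * (v / (\<i> * of_real (Im z)))" "norm (v / (\<i> * of_real (Im z))) = 1"
    by (simp_all add: norm_divide norm_mult)
  with \<open>z \<in> H2\<close> show "(z, v) \<in> {(z, \<i> * of_real (Im z) * u) | z u. z \<in> H2 \<and> norm u = 1}"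
    by blast
next
  fix z v assume "(z, v) \<in> {(z, \<i> * of_real (Im z) * u) | z u. z \<in> H2 \<and> norm u = 1}"
  then show "(z, v) \<in> UTH2"
    by (auto simp: UTH2_def hyp_norm_eq_1 norm_mult) (simp add: H2_def)
qed

text \<open>A unit vector determines its ray and hence its endpoint, limits in \<open>CP1\<close>
  being unique; since \<open>direction z\<close> inverts \<open>endpoint z\<close>, the endpoint
  conversely determines the vector.\<close>

lemma initial_tangent_iff:
  assumes z: "z \<in> H2" and r: "r \<in> RP1"
  shows "initial_tangent z r v \<longleftrightarrow> v = \<i> * of_real (Im z) * direction z r"
proof
  assume "initial_tangent z r v"
  then obtain \<gamma> where UT: "(z, v) \<in> UTH2" and \<gamma>: "geodesic_ray \<gamma>" "\<gamma> 0 = z"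
    "(\<gamma> has_vector_derivative v) (at 0 within {0..})" "limitin CP1 (\<lambda>t. Some (\<gamma> t)) r at_top"
    unfolding initial_tangent_def by blast
  obtain u where u: "v = \<i> * of_real (Im z) * u" "norm u = 1"
    using UT by (auto simp: UTH2_eq)
  have "\<forall>\<^sub>F t in at_top. Some (unit_geodesic z u t) = Some (\<gamma> t)"
    using eventually_ge_at_top[of 0]
  proof eventually_elim
    case (elim t)
    then show ?case using geodesic_ray_eq_unit_geodesic[OF \<gamma>(1-3) u elim] by simp
  qed
  then have "limitin CP1 (\<lambda>t. Some (\<gamma> t)) (endpoint z u) at_top"
    by (rule limitin_transform_eventually[OF _ unit_geodesic_limit[OF z u(2)]])
  then have "r = endpoint z u"
    by (intro limitin_Hausdorff_unique[OF \<gamma>(4)]) (simp_all add: Hausdorff_CP1)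
  then show "v = \<i> * of_real (Im z) * direction z r"
    using direction_endpoint[OF z u(2)] u(1) by simp
next
  assume v: "v = \<i> * of_real (Im z) * direction z r"
  have "(z, v) \<in> UTH2" using v z norm_direction[OF z r] by (auto simp: UTH2_eq)
  moreover have "limitin CP1 (\<lambda>t. Some (unit_geodesic z (direction z r) t)) r at_top"
    using unit_geodesic_limit[OF z norm_direction[OF z r]] by (simp only: endpoint_direction[OF z r])
  ultimately show "initial_tangent z r v"
    unfolding initial_tangent_def
    by (intro conjI exI[of _ "unit_geodesic z (direction z r)"])
      (simp_all add: v unit_geodesic_0 unit_geodesic[OF z norm_direction[OF z r]])
qed

section \<open>The map on root sets\<close>

lemma Some_notin_RP1: "Im z \<noteq> 0 \<Longrightarrow> Some z \<notin> RP1"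
  by (auto simp: RP1_def complex_is_Real_iff)

text \<open>The conjugate roots lie strictly on opposite sides of the real line, so either of them
  identifies \<open>z\<close> although a multiset carries no order.\<close>

lemma Some_in_root_set:
  assumes "r \<in> RP1" "z \<in> H2" "w \<in> H2"
  shows "Some w \<in># root_set r z \<longleftrightarrow> w = z" "Some (cnj w) \<in># root_set r z \<longleftrightarrow> w = z"
  using assms Some_notin_RP1[of w] Some_notin_RP1[of "cnj w"]
  by (auto simp: root_set_def H2_def complex_eq_iff)

lemma root_set_eq_iff:
  assumes "r \<in> RP1" "z \<in> H2" "r' \<in> RP1" "z' \<in> H2"
  shows "root_set r z = root_set r' z' \<longleftrightarrow> r = r' \<and> z = z'"
proof
  assume eq: "root_set r z = root_set r' z'"
  have "Some z \<in># root_set r z" by (simp add: root_set_def)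
  then have "z = z'"
    using Some_in_root_set[OF assms(3,4,2)] by (simp add: eq)
  with eq show "r = r' \<and> z = z'" by (simp add: root_set_def)
qed simp

text \<open>Exactly one pair meets the definite description: the root set determines
  \<open>r\<close> and \<open>z\<close>, and these determine the vector.\<close>

lemma Phi_root_set:
  assumes r: "r \<in> RP1" and z: "z \<in> H2"
  shows "Phi (root_set r z) = (z, \<i> * of_real (Im z) * direction z r)"
  unfolding Phi_def
  by (rule the_equality) (use assms initial_tangent_iff in \<open>auto simp: root_set_eq_iff\<close>)

section \<open>Topology\<close>

lemma ii_H2 [simp]: "\<i> \<in> H2"
  by (simp add: H2_def)

lemma topspace_CP1 [simp]: "topspace CP1 = UNIV"
  by (auto simp: CP1_def notin_range_Some)

text \<open>Open sets of \<open>CP1\<close> are of two kinds. For those missing \<open>None\<close>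
  the rational formula is continuous off \<open>1\<close>; for the others the complement of the
  preimage is the image under \<open>direction z\<close> of a compact set of reals.\<close>

lemma continuous_map_endpoint:
  assumes z: "z \<in> H2"
  shows "continuous_map (top_of_set (sphere 0 1)) CP1 (endpoint z)"
proof -
  let ?S = "sphere 0 1 :: complex set"
  define f where "f = (\<lambda>u. of_real (Re z - Im z * Im u / (1 - Re u)) :: complex)"
  have "openin (top_of_set ?S) {u \<in> ?S. endpoint z u \<in> U}" if "openin CP1 U" for U
    using that unfolding CP1_def openin_Alexandroff_compactification
  proof (elim disjE exE conjE)
    fix V assume V: "openin euclidean V" "U = Some ` V"
    have "1 - Re u \<noteq> 0" if "u \<in> ?S - {1}" for u
      using that unit_Re_eq_1[of u] by auto
    then have "continuous_on (?S - {1}) f"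
      unfolding f_def by (intro continuous_intros) auto
    then have "openin (top_of_set (?S - {1})) ((?S - {1}) \<inter> f -` V)"
      using V(1) by (simp add: continuous_openin_preimage_gen)
    moreover have "openin (top_of_set ?S) (?S - {1})"
      by (simp add: openin_delete)
    moreover have "{u \<in> ?S. endpoint z u \<in> U} = (?S - {1}) \<inter> f -` V"
      by (auto simp: V(2) endpoint_def f_def split: if_splits)
    ultimately show ?thesis by (metis openin_trans)
  next
    fix C assume C: "compactin euclidean C" "U = insert None (Some ` (topspace euclidean - C))"
    have "compact ((\<lambda>a. direction z (Some a)) ` (C \<inter> \<real>))"
    proof (rule compact_continuous_image)
      have "a - cnj z \<noteq> 0" if "a \<in> \<real>" for a
        using that real_minus_cnj_nonzero[OF z] by (auto simp: Reals_def)
      then show "continuous_on (C \<inter> \<real>) (\<lambda>a. direction z (Some a))"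
        by (auto intro!: continuous_intros)
      show "compact (C \<inter> \<real>)" 
        using C(1) by (simp add: compact_Int_closed closed_complex_Reals)
    qed
    then have "openin (top_of_set ?S) (?S - (\<lambda>a. direction z (Some a)) ` (C \<inter> \<real>))"
      by (metis Diff_eq compact_imp_closed open_Compl openin_open_Int)
    moreover have "{u \<in> ?S. endpoint z u \<in> U} = ?S - (\<lambda>a. direction z (Some a)) ` (C \<inter> \<real>)"
    proof (intro subset_antisym subsetI)
      fix u assume u: "u \<in> {u \<in> ?S. endpoint z u \<in> U}"
      have "endpoint z (direction z (Some a)) = Some a" if "a \<in> \<real>" for a
        using that endpoint_direction[OF z, of "Some a"] by (simp add: RP1_def)
      then show "u \<in> ?S - (\<lambda>a. direction z (Some a)) ` (C \<inter> \<real>)"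
        using u C(2) by fastforce
    next
      fix u assume u: "u \<in> ?S - (\<lambda>a. direction z (Some a)) ` (C \<inter> \<real>)"
      then have "a \<notin> C" if "endpoint z u = Some a" for a
        using that direction_endpoint[OF z, of u] endpoint_in_RP1[of z u] by (force simp: RP1_def)
      then show "u \<in> {u \<in> ?S. endpoint z u \<in> U}"
        using C(2) u by (cases "endpoint z u") auto
    qed
    ultimately show ?thesis by simp
  qed
  then show ?thesis by (simp add: continuous_map)
qed

text \<open>A continuous bijection from a compact to a Hausdorff space; continuity of
  \<open>direction z\<close>, also at \<open>None\<close>, follows.\<close>

lemma homeomorphic_maps_endpoint:
  assumes z: "z \<in> H2"
  shows "homeomorphic_maps (top_of_set (sphere 0 1)) (subtopology CP1 RP1) (endpoint z) (direction z)"
proof -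
  have "homeomorphic_map (top_of_set (sphere 0 1)) (subtopology CP1 RP1) (endpoint z)"
  proof (rule continuous_imp_homeomorphic_map)
    show "continuous_map (top_of_set (sphere 0 1)) (subtopology CP1 RP1) (endpoint z)"
      by (simp add: continuous_map_in_subtopology continuous_map_endpoint[OF z] endpoint_in_RP1)
    show "Hausdorff_space (subtopology CP1 RP1)"
      by (simp add: Hausdorff_CP1 Hausdorff_space_subtopology)
    show "endpoint z ` topspace (top_of_set (sphere 0 1)) = topspace (subtopology CP1 RP1)"
    proof
      show "topspace (subtopology CP1 RP1) \<subseteq> endpoint z ` topspace (top_of_set (sphere 0 1))"
      proof
        fix r assume "r \<in> topspace (subtopology CP1 RP1)"
        then have "r \<in> RP1" by simp
        then show "r \<in> endpoint z ` topspace (top_of_set (sphere 0 1))"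
          using endpoint_direction[OF z] norm_direction[OF z] by (intro image_eqI[of _ _ "direction z r"]) auto
      qed
    qed (auto simp: endpoint_in_RP1)
    show "inj_on (endpoint z) (topspace (top_of_set (sphere 0 1)))"
      by (rule inj_on_inverseI[of _ "direction z"]) (simp add: direction_endpoint[OF z])
  qed (simp add: compact_space_subtopology)
  then obtain g where g: "homeomorphic_maps (top_of_set (sphere 0 1)) (subtopology CP1 RP1) (endpoint z) g"
    by (auto simp: homeomorphic_map_maps)
  show ?thesis
  proof (rule homeomorphic_maps_eq[OF g refl])
    fix r assume r: "r \<in> topspace (subtopology CP1 RP1)"
    then have "g r \<in> sphere 0 1" "endpoint z (g r) = r"
      using g by (auto simp: homeomorphic_maps_def continuous_map_def)
    then show "g r = direction z r"
      using direction_endpoint[OF z] by fastforce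
  qed
qed

text \<open>The saturation of an open set is the union of its preimages under the six coordinate
  permutations, each of them continuous.\<close>

lemma open_map_triple_mset:
  "open_map (prod_topology X (prod_topology X X)) (SP3 X) triple_mset"
  unfolding open_map_def openin_SP3
proof (intro allI impI conjI)
  let ?P = "prod_topology X (prod_topology X X)"
  fix U assume U: "openin ?P U"
  then have sub: "U \<subseteq> topspace ?P" by (rule openin_subset)
  then show "triple_mset ` U \<subseteq> triple_mset ` topspace ?P" by blast
  note proj = continuous_map_fst
    continuous_map_compose[OF continuous_map_snd continuous_map_fst, unfolded o_def]
    continuous_map_compose[OF continuous_map_snd continuous_map_snd, unfolded o_def]
  have op: "openin ?P {t \<in> topspace ?P. f t \<in> U}" if "continuous_map ?P ?P f" for f
    using that U by (rule openin_continuous_map_preimage)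
  have "{t \<in> topspace ?P. triple_mset t \<in> triple_mset ` U} =
      {t \<in> topspace ?P. (fst t, fst (snd t), snd (snd t)) \<in> U} \<union>
      {t \<in> topspace ?P. (fst t, snd (snd t), fst (snd t)) \<in> U} \<union>
      {t \<in> topspace ?P. (fst (snd t), fst t, snd (snd t)) \<in> U} \<union>
      {t \<in> topspace ?P. (fst (snd t), snd (snd t), fst t) \<in> U} \<union>
      {t \<in> topspace ?P. (snd (snd t), fst t, fst (snd t)) \<in> U} \<union>
      {t \<in> topspace ?P. (snd (snd t), fst (snd t), fst t) \<in> U}" (is "?L = ?R")
  proof (intro subset_antisym subsetI)
    fix t assume "t \<in> ?L"
    then obtain a b c a' b' c' where t: "t = (a, b, c)" "t \<in> topspace ?P" "(a', b', c') \<in> U"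
      "{#a, b, c#} = {#a', b', c'#}"
      by (auto simp: triple_mset_def)
    then show "t \<in> ?R"
      by (auto simp: add_eq_conv_ex)
  next
    fix t assume "t \<in> ?R"
    then show "t \<in> ?L"
      by (auto simp: triple_mset_def intro!: rev_image_eqI)
  qed
  also have "openin ?P \<dots>"
    by (intro openin_Un op continuous_map_pairedI proj)
  finally show "openin ?P {t \<in> topspace ?P. triple_mset t \<in> triple_mset ` U}" .
qed

section \<open>Root sets as a product of boundary and half plane\<close>

lemma root_set_eq_triple_mset: "root_set r z = triple_mset (r, Some z, Some (cnj z))"
  by (simp add: root_set_def triple_mset_def)

text \<open>Continuity goes through the quotient map. For openness, a basic open set around
  \<open>(r, z)\<close> is thickened to a product of three open sets of \<open>CP1\<close>, whose
  open image is cut down to \<open>R_neg\<close>.\<close>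

lemma homeomorphic_map_root_set:
  "homeomorphic_map (prod_topology (subtopology CP1 RP1) (top_of_set H2)) R_neg_top (\<lambda>(r, z). root_set r z)"
proof (rule bijective_open_imp_homeomorphic_map)
  let ?P = "prod_topology (subtopology CP1 RP1) (top_of_set H2)"
  let ?f = "\<lambda>(r, z). root_set r z"
  have Rsub: "R_neg \<subseteq> topspace (SP3 CP1)"
    by (auto simp: topspace_SP3 R_neg_def root_set_eq_triple_mset)
  show im: "?f ` topspace ?P = topspace R_neg_top"
    using Rsub by (auto simp: R_neg_top_def R_neg_def)
  show "inj_on ?f (topspace ?P)"
    by (auto simp: inj_on_def root_set_eq_iff)
  have "continuous_map (top_of_set H2) CP1 (\<lambda>z. Some z)" "continuous_map (top_of_set H2) CP1 (\<lambda>z. Some (cnj z))"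
    unfolding CP1_def
    by (rule continuous_map_compose[OF _ continuous_map_Some, unfolded o_def];
        simp add: continuous_intros)+
  from this[THEN continuous_map_compose[OF continuous_map_snd], unfolded o_def]
  have "continuous_map ?P (prod_topology CP1 (prod_topology CP1 CP1)) (\<lambda>x. (fst x, Some (snd x), Some (cnj (snd x))))"
    by (intro continuous_map_pairedI continuous_map_into_fulltopology[OF continuous_map_fst])
  from continuous_map_compose[OF this quotient_imp_continuous_map[OF quotient_map_triple_mset]]
  have "continuous_map ?P (SP3 CP1) ?f"
    by (simp add: o_def case_prod_unfold root_set_eq_triple_mset)
  then show "continuous_map ?P R_neg_top ?f"
    unfolding R_neg_top_def by (rule continuous_map_into_subtopology) (auto simp: R_neg_def)
  show "open_map ?P R_neg_top ?f"
    unfolding open_map_def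
  proof (intro allI impI)
    fix W assume W: "openin ?P W"
    show "openin R_neg_top (?f ` W)"
    proof (subst openin_subopen, intro ballI)
      fix m assume "m \<in> ?f ` W"
      then obtain r z where rz: "(r, z) \<in> W" "m = root_set r z" by auto
      then obtain A B where A: "openin (subtopology CP1 RP1) A" "r \<in> A"
        and B: "openin (top_of_set H2) B" "z \<in> B" and AB: "A \<times> B \<subseteq> W"
        using W unfolding openin_prod_topology_alt by meson
      obtain A' where A': "openin CP1 A'" "A = A' \<inter> RP1"
        using A by (auto simp: openin_subtopology)
      have "open H2" unfolding H2_def by (rule open_halfspace_Im_gt)
      then have B': "open B" "B \<subseteq> H2" using B by (auto simp: openin_open_eq)
      \<comment> \<open>The second and third entries range independently; only the intersection with
        \<open>R_neg\<close> makes them conjugate.\<close>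
      define N where "N = R_neg \<inter> triple_mset ` (A' \<times> Some ` B \<times> Some ` cnj ` B)"
      have "cnj ` B = cnj -` B" by (force simp: image_iff)
      then have "open (cnj ` B)"
        using B' by (simp add: continuous_on_cnj open_vimage continuous_on_id)
      then have "openin (SP3 CP1) (triple_mset ` (A' \<times> Some ` B \<times> Some ` cnj ` B))"
        using A' B' open_map_triple_mset[of CP1]
        by (auto simp: open_map_def CP1_def openin_prod_Times_iff)
      then have "openin R_neg_top N"
        unfolding N_def R_neg_top_def by (simp add: openin_subtopology_Int2)
      moreover have "m \<in> N"
        using A A' B B' rz by (auto simp: N_def R_neg_def root_set_eq_triple_mset)
      moreover have "N \<subseteq> ?f ` W"
      proof
        fix m' assume "m' \<in> N"
        then obtain a b b' s w where m': "m' = {#a, Some b, Some (cnj b')#}" "m' = root_set s w"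
          "a \<in> A'" "b \<in> B" "b' \<in> B" "s \<in> RP1" "w \<in> H2"
          by (simp add: N_def R_neg_def triple_mset_def image_iff) metis
        \<comment> \<open>\<open>w\<close> is the only root of \<open>root_set s w\<close> above the
          real axis and \<open>cnj w\<close> the only one below, which forces the two choices from
          \<open>B\<close> to coincide.\<close>
        have "b = w" "b' = w"
          using Some_in_root_set[OF m'(6,7)] m' B' by (metis add_mset_commute subsetD union_single_eq_member)+
        then have "a = s" "w \<in> B" using m' by (auto simp: root_set_def)
        then show "m' \<in> ?f ` W"
          using m' AB A' by (intro image_eqI[of _ _ "(s, w)"]) auto
      qed
      ultimately show "\<exists>N. openin R_neg_top N \<and> m \<in> N \<and> N \<subseteq> ?f ` W" by blast
    qed
  qed
qed

text \<open>The transition map, on the unit circle, from the Cayley chart at \<open>i\<close> to the one at \<open>z\<close>, and its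
  inverse.\<close>

definition base_change :: "complex \<Rightarrow> complex \<Rightarrow> complex" where
  "base_change z w = (w * (\<i> + z) + (\<i> - z)) / (w * (\<i> + cnj z) + (\<i> - cnj z))"

definition base_change_inv :: "complex \<Rightarrow> complex \<Rightarrow> complex" where
  "base_change_inv z u = (u * (\<i> - cnj z) - (\<i> - z)) / ((\<i> + z) - u * (\<i> + cnj z))"

text \<open>At a finite real \<open>a\<close>, numerators and denominators factor into a constant
  and linear terms such as \<open>a - z\<close>, \<open>a - cnj z\<close>, \<open>a + \<i>\<close>,
  which cancel. The nonvanishing of the denominators serves continuity later.\<close>

lemma base_change:
  assumes z: "z \<in> H2" and r: "r \<in> RP1"
  shows "direction \<i> r * (\<i> + cnj z) + (\<i> - cnj z) \<noteq> 0" (is ?A)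
    and "base_change z (direction \<i> r) = direction z r" (is ?B)
    and "(\<i> + z) - direction z r * (\<i> + cnj z) \<noteq> 0" (is ?C)
    and "base_change_inv z (direction z r) = direction \<i> r" (is ?D)
proof -
  have zz: "z - cnj z \<noteq> 0" using z by (auto simp: H2_def complex_eq_iff)
  have "?A \<and> ?B \<and> ?C \<and> ?D"
  proof (cases r)
    case None
    then show ?thesis using zz by (simp add: base_change_def base_change_inv_def)
  next
    case (Some a)
    then obtain x where "a = of_real x" using r by (auto simp: RP1_def Reals_def)
    then have nz: "a - cnj z \<noteq> 0" "a + \<i> \<noteq> 0" "a - \<i> \<noteq> 0"
      using real_minus_cnj_nonzero[OF z, of x] by (auto simp: complex_eq_iff)
    have d: "direction \<i> r = (a - \<i>) / (a + \<i>)" "direction z r = (a - z) / (a - cnj z)"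
      using Some by simp_all
    \<comment> \<open>Used with \<open>w = z\<close> for the numerator and \<open>w = cnj z\<close>
      for the denominator of \<open>base_change\<close>.\<close>
    have 1: "direction \<i> r * (\<i> + w) + (\<i> - w) = 2 * \<i> * (a - w) / (a + \<i>)" for w
      unfolding d using nz by (simp add: field_simps)
    have 2: "direction z r * (\<i> - cnj z) - (\<i> - z) = (z - cnj z) * (a - \<i>) / (a - cnj z)"
      unfolding d using nz by (simp add: field_simps)
    have 3: "(\<i> + z) - direction z r * (\<i> + cnj z) = (z - cnj z) * (a + \<i>) / (a - cnj z)"
      unfolding d using nz by (simp add: field_simps)
    show ?thesis
      unfolding base_change_def base_change_inv_def 1 2 3 using nz zz by (simp add: d)
  qed
  then show ?A ?B ?C ?D by blast+
qed

lemma homeomorphic_maps_base_change: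
  "homeomorphic_maps (prod_topology (top_of_set (sphere 0 1)) (top_of_set H2)) UTH2_top
     (\<lambda>(w, z). (z, \<i> * of_real (Im z) * base_change z w))
     (\<lambda>(z, v). (base_change_inv z (v / (\<i> * of_real (Im z))), z))"
proof -
  \<comment> \<open>Every unit number is the direction of a boundary point, so the facts proved for
    each \<open>r\<close> become facts about the whole circle.\<close>
  have w: "\<exists>r\<in>RP1. w = direction z r" if "w \<in> sphere 0 1" "z \<in> H2" for w z
    using that direction_endpoint[of z w] endpoint_in_RP1[of z w] by force
  have 1: "w * (\<i> + cnj z) + (\<i> - cnj z) \<noteq> 0" "base_change z w \<in> sphere 0 1"
    "base_change_inv z (base_change z w) = w" if wz: "w \<in> sphere 0 1" "z \<in> H2" for w z
    using w[OF wz(1) ii_H2] wz(2) by (auto simp: base_change norm_direction)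
  have 2: "(\<i> + z) - u * (\<i> + cnj z) \<noteq> 0" "base_change_inv z u \<in> sphere 0 1"
    "base_change z (base_change_inv z u) = u" if uz: "u \<in> sphere 0 1" "z \<in> H2" for u z
    using w[OF uz] base_change[OF uz(2)] by (auto simp: norm_direction)
  have y: "Im z \<noteq> 0" if "z \<in> H2" for z using that by (simp add: H2_def)
  have UT: "z \<in> H2" "v / (\<i> * of_real (Im z)) \<in> sphere 0 1" if "(z, v) \<in> UTH2" for z v
    using that y by (auto simp: UTH2_eq)
  have "homeomorphism (sphere 0 1 \<times> H2) UTH2
     (\<lambda>(w, z). (z, \<i> * of_real (Im z) * base_change z w))
     (\<lambda>(z, v). (base_change_inv z (v / (\<i> * of_real (Im z))), z))"
  proof (rule homeomorphismI)
    show "continuous_on (sphere 0 1 \<times> H2) (\<lambda>(w, z). (z, \<i> * of_real (Im z) * base_change z w))"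
      unfolding case_prod_unfold base_change_def
      by (intro continuous_intros) (use 1(1) in auto)
    show "continuous_on UTH2 (\<lambda>(z, v). (base_change_inv z (v / (\<i> * of_real (Im z))), z))"
      unfolding case_prod_unfold base_change_inv_def
      by (intro continuous_intros) (use 2(1)[OF UT(2,1)] UT(1) y in auto)
    show "(\<lambda>(w, z). (z, \<i> * of_real (Im z) * base_change z w)) ` (sphere 0 1 \<times> H2) \<subseteq> UTH2"
      using 1(2) by (fastforce simp: UTH2_eq)
    show "(\<lambda>(z, v). (base_change_inv z (v / (\<i> * of_real (Im z))), z)) ` UTH2 \<subseteq> sphere 0 1 \<times> H2"
      using 2(2)[OF UT(2,1)] UT(1) by auto
  qed (use 1(3) 2(3)[OF UT(2,1)] UT(1) y in auto)
  then show ?thesis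
    by (simp add: UTH2_top_def homeomorphic_maps_def homeomorphism_def prod_topology_subtopology_eu) blast
qed

text \<open>The fixed chart at \<open>\<i>\<close> for \<open>r\<close> makes the source a product
  of circle and half plane, and \<open>base_change\<close> then yields the direction at the moving
  point \<open>z\<close>. Joint continuity in \<open>r\<close> and \<open>z\<close> is thus reduced
  to that of a rational map.\<close>

lemma homeomorphic_map_Phi: "homeomorphic_map R_neg_top UTH2_top Phi"
proof -
  let ?S = "top_of_set (sphere 0 1) :: complex topology" and ?H = "top_of_set H2"
  let ?f = "(\<lambda>(r, z). root_set r z) \<circ> (\<lambda>(w, z). (endpoint \<i> w, z))"
  let ?h = "\<lambda>(w, z). (z, \<i> * of_real (Im z) * base_change z w)"
  have "homeomorphic_map (prod_topology ?S ?H) (prod_topology (subtopology CP1 RP1) ?H)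
      (\<lambda>(w, z). (endpoint \<i> w, z))"
    using homeomorphic_maps_endpoint[OF ii_H2]
    unfolding homeomorphic_map_maps
    by (intro exI[of _ "\<lambda>(r, z). (direction \<i> r, z)"])
      (simp only: homeomorphic_maps_prod homeomorphic_maps_id[unfolded id_def] simp_thms)
  from homeomorphic_map_compose[OF this homeomorphic_map_root_set]
  obtain g where g: "homeomorphic_maps (prod_topology ?S ?H) R_neg_top ?f g"
    by (auto simp: homeomorphic_map_maps)
  have "homeomorphic_map R_neg_top UTH2_top (?h \<circ> g)"
    using g homeomorphic_maps_base_change by (intro homeomorphic_map_compose) (auto simp: homeomorphic_maps_map)
  then show ?thesis
  proof (rule homeomorphic_map_eq)
    fix m assume m: "m \<in> topspace R_neg_top"
    obtain w z where gm: "g m = (w, z)" by fastforce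
    then have wz: "w \<in> sphere 0 1" "z \<in> H2" "root_set (endpoint \<i> w) z = m"
      using m g by (auto simp: homeomorphic_maps_def continuous_map_def Pi_def)
    then show "(?h \<circ> g) m = Phi m"
      using Phi_root_set[OF endpoint_in_RP1 wz(2), of \<i> w]
        base_change(2)[OF wz(2) endpoint_in_RP1, of \<i> w] direction_endpoint[OF ii_H2, of w]
      by (simp add: gm)
  qed
qed

section \<open>Equivariance\<close>

context
  fixes A :: "real^2^2" and a b c d :: complex
  assumes det: "det A = 1"
  defines "a \<equiv> of_real (A$1$1)" and "b \<equiv> of_real (A$1$2)"
    and "c \<equiv> of_real (A$2$1)" and "d \<equiv> of_real (A$2$2)"
begin

lemma det_entries: "a * d - b * c = 1"
  unfolding a_def b_def c_def d_def using det unfolding det_2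
  by (metis of_real_1 of_real_diff of_real_mult)

lemma moebius_map_eq: "moebius_map A z = (a * z + b) / (c * z + d)"
  by (simp add: moebius_map_def moebius_def a_def b_def c_def d_def)

lemma cnj_entries: "cnj a = a" "cnj b = b" "cnj c = c" "cnj d = d"
  by (simp_all add: a_def b_def c_def d_def)

text \<open>\<open>c\<close> and \<open>d\<close> are real, so vanishing at a non-real
  \<open>z\<close> forces \<open>c = 0\<close> and then \<open>d = 0\<close>, against determinant
  \<open>1\<close>.\<close>

lemma moebius_denom_nonzero:
  assumes "Im z \<noteq> 0"
  shows "c * z + d \<noteq> 0"
proof
  assume 0: "c * z + d = 0"
  then have "A$2$1 * Im z = 0"
    by (simp add: c_def d_def complex_eq_iff)
  then have "c = 0" using assms by (simp add: c_def)
  with 0 det_entries show False by simp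
qed

lemma moebius_map_diff:
  assumes "c * z + d \<noteq> 0" "c * w + d \<noteq> 0"
  shows "moebius_map A z - moebius_map A w = (z - w) / ((c * z + d) * (c * w + d))"
proof -
  have "(a * z + b) * (c * w + d) - (a * w + b) * (c * z + d) = (a * d - b * c) * (z - w)"
    by (simp add: algebra_simps)
  then show ?thesis
    using assms by (simp add: moebius_map_eq diff_frac_eq det_entries)
qed

lemma moebius_map_cnj: "moebius_map A (cnj z) = cnj (moebius_map A z)"
  by (simp add: moebius_map_eq cnj_entries)

text \<open>The difference formula at \<open>z\<close> and \<open>cnj z\<close>. The denominator
  stays a product of conjugate factors, not a squared norm, so that one factor can cancel in
  \<open>Phi_SL_act\<close>.\<close>

lemma Im_moebius_map:
  assumes z: "z \<in> H2"
  shows "of_real (Im (moebius_map A z)) = of_real (Im z) / ((c * z + d) * (c * cnj z + d))"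
proof -
  have nz: "c * z + d \<noteq> 0" "c * cnj z + d \<noteq> 0"
    using z moebius_denom_nonzero[of z] moebius_denom_nonzero[of "cnj z"] by (auto simp: H2_def)
  have "2 * \<i> * of_real (Im (moebius_map A z)) = moebius_map A z - moebius_map A (cnj z)"
    by (simp add: moebius_map_cnj complex_diff_cnj)
  also have "\<dots> = 2 * \<i> * (of_real (Im z) / ((c * z + d) * (c * cnj z + d)))"
    by (simp add: moebius_map_diff[OF nz] complex_diff_cnj)
  finally show ?thesis by (simp only: mult_cancel_left) simp
qed

lemma moebius_map_H2:
  assumes z: "z \<in> H2"
  shows "moebius_map A z \<in> H2"
proof -
  have "of_real (Im (moebius_map A z)) = (of_real (Im z / (norm (c * z + d))\<^sup>2) :: complex)"
    unfolding Im_moebius_map[OF z] using complex_norm_square[of "c * z + d"] by (simp add: cnj_entries)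
  then have "Im (moebius_map A z) = Im z / (norm (c * z + d))\<^sup>2"
    by (simp only: of_real_eq_iff)
  then show ?thesis
    using z moebius_denom_nonzero[of z] by (simp add: H2_def)
qed

lemma moebius_CP1_RP1: "r \<in> RP1 \<Longrightarrow> moebius_CP1 A r \<in> RP1"
  by (cases r) (auto simp: RP1_def moebius_map_eq a_def b_def c_def d_def)

lemma moebius_CP1_H2:
  assumes "z \<in> H2"
  shows "moebius_CP1 A (Some z) = Some (moebius_map A z)"
    and "moebius_CP1 A (Some (cnj z)) = Some (cnj (moebius_map A z))"
  using assms moebius_denom_nonzero[of z] moebius_denom_nonzero[of "cnj z"]
  by (auto simp: moebius_map_cnj H2_def c_def d_def)

text \<open>In the quotient of the difference formulas at \<open>z\<close> and \<open>cnj z\<close>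
  the factor belonging to \<open>r\<close> cancels. Infinity and the pole of the map, which those
  formulas do not cover, are treated apart.\<close>

lemma direction_moebius:
  assumes z: "z \<in> H2" and r: "r \<in> RP1"
  shows "direction (moebius_map A z) (moebius_CP1 A r) = direction z r * ((c * cnj z + d) / (c * z + d))"
proof -
  have nz: "c * z + d \<noteq> 0" "c * cnj z + d \<noteq> 0"
    using z moebius_denom_nonzero[of z] moebius_denom_nonzero[of "cnj z"] by (auto simp: H2_def)
  show ?thesis
  proof (cases r)
    case None
    show ?thesis
    proof (cases "c = 0")
      case True
      then show ?thesis using None nz by (simp add: c_def)
    next
      case False
      \<comment> \<open>\<open>a / c\<close> is the image of infinity, and this is the limiting form
        of the difference formula.\<close>
      have *: "a / c - moebius_map A w = 1 / (c * (c * w + d))" if "c * w + d \<noteq> 0" for w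
        using that False det_entries by (simp add: moebius_map_eq diff_frac_eq algebra_simps)
      have "moebius_CP1 A r = Some (a / c)" using None False by (simp add: a_def c_def)
      then show ?thesis
        using False nz None *[OF nz(1)] *[OF nz(2)] by (simp add: moebius_map_cnj[symmetric])
    qed
  next
    case (Some x)
    have x: "x - cnj z \<noteq> 0"
      using r Some real_minus_cnj_nonzero[OF z] by (auto simp: RP1_def Reals_def)
    show ?thesis
    proof (cases "c * x + d = 0")
      case True
      \<comment> \<open>The pole \<open>x\<close> goes to infinity, whose direction is
        \<open>1\<close>, so the factor on the right has to be the inverse of
        \<open>direction z r\<close>.\<close>
      then have d: "d = - c * x" by (simp add: add_eq_0_iff)
      have "moebius_CP1 A r = None" using Some True by (simp add: c_def d_def)
      moreover have "c * z + d = c * (z - x)" "c * cnj z + d = c * (cnj z - x)"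
        by (simp_all add: d algebra_simps)
      ultimately show ?thesis
        using x nz Some by (simp add: divide_simps) (simp add: algebra_simps)
    next
      case False
      then have "moebius_CP1 A r = Some (moebius_map A x)" using Some by (simp add: c_def d_def)
      then show ?thesis
        using False nz Some x
        by (simp add: moebius_map_cnj[symmetric] moebius_map_diff)
    qed
  qed
qed

section \<open>Action on tangent vectors and root sets\<close>

lemma frechet_derivative_moebius_map:
  assumes z: "z \<in> H2"
  shows "frechet_derivative (moebius_map A) (at z) v = v / (c * z + d)\<^sup>2"
proof -
  have nz: "c * z + d \<noteq> 0"
    using z moebius_denom_nonzero[of z] by (auto simp: H2_def)
  have "(moebius_map A has_field_derivative (a * (c * z + d) - (a * z + b) * c) / (c * z + d)\<^sup>2) (at z)"
    unfolding moebius_map_eq[abs_def] using nz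
    by (auto intro!: derivative_eq_intros simp: power2_eq_square)
  \<comment> \<open>The numerator of the quotient rule is the determinant.\<close>
  also have "a * (c * z + d) - (a * z + b) * c = 1"
    using det_entries by (simp add: algebra_simps)
  finally have "(moebius_map A has_derivative (\<lambda>v. 1 / (c * z + d)\<^sup>2 * v)) (at z)"
    by (simp only: has_field_derivative_def)
  from frechet_derivative_at[OF this, symmetric] show ?thesis by simp
qed

lemma SL_act_root_set:
  assumes "z \<in> H2"
  shows "SL_act_roots A (root_set r z) = root_set (moebius_CP1 A r) (moebius_map A z)"
  using moebius_CP1_H2[OF assms] by (simp add: SL_act_roots_def root_set_def)

text \<open>The height scales by \<open>1 / ((c * z + d) * (c * cnj z + d))\<close> and the
  direction turns by \<open>(c * cnj z + d) / (c * z + d)\<close>; the product is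
  \<open>1 / (c * z + d)\<^sup>2\<close>, the derivative of the map.\<close>

lemma Phi_SL_act:
  assumes "m \<in> R_neg"
  shows "Phi (SL_act_roots A m) = SL_act_UT A (Phi m)"
proof -
  obtain r z where m: "m = root_set r z" and r: "r \<in> RP1" and z: "z \<in> H2"
    using assms by (auto simp: R_neg_def)
  have nz: "c * z + d \<noteq> 0" "c * cnj z + d \<noteq> 0"
    using z moebius_denom_nonzero[of z] moebius_denom_nonzero[of "cnj z"] by (auto simp: H2_def)
  have "of_real (Im (moebius_map A z)) * direction (moebius_map A z) (moebius_CP1 A r) =
      of_real (Im z) * direction z r / (c * z + d)\<^sup>2"
    unfolding Im_moebius_map[OF z] direction_moebius[OF z r] using nz
    by (simp add: power2_eq_square)
  then show ?thesis
    by (simp add: m SL_act_root_set[OF z] Phi_root_set[OF moebius_CP1_RP1[OF r] moebius_map_H2[OF z]]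
        Phi_root_set[OF r z] SL_act_UT_def frechet_derivative_moebius_map[OF z] mult.assoc)
qed

end

theorem proposition4p17:
  shows "(\<forall>z\<in>H2. \<forall>r\<in>RP1. \<exists>!v. initial_tangent z r v)
    \<and> homeomorphic_map R_neg_top UTH2_top Phi
    \<and> (\<forall>C\<in>carrier PSL2R. \<forall>m\<in>R_neg. Phi (PSL_act_roots C m) = PSL_act_UT C (Phi m))"
proof (intro conjI ballI)
  show "\<exists>!v. initial_tangent z r v" if "z \<in> H2" "r \<in> RP1" for z r
    using that by (simp add: initial_tangent_iff)
  show "homeomorphic_map R_neg_top UTH2_top Phi"
    by (rule homeomorphic_map_Phi)
  fix C m assume C: "C \<in> carrier PSL2R" and m: "m \<in> R_neg"
  \<comment> \<open>One representative of the coset suffices, as \<open>A\<close> and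
    \<open>- A\<close> act alike on both spaces.\<close>
  then obtain A where A: "det A = 1" "A \<in> C" by (auto simp: carrier_PSL2R)
  show "Phi (PSL_act_roots C m) = PSL_act_UT C (Phi m)"
    unfolding PSL_act_eq[OF C A(2)] by (rule Phi_SL_act[OF A(1) m])
qed

end
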